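(* Let $G$ be a graph on $n\ge 2$ vertices, with vertex degrees $d_1\ge d_2\ge\cdots\ge d_n$ and Laplacian eigenvalues $\lambda_1\ge\lambda_2\ge\cdots\ge\lambda_n(=0)$. Then the isoperimetric number $i(G)$ satisfies $$i(G)\;\le\;\min_{\frac{n}{2}\le m<n}\;\sum_{i=1}^{m}(\lambda_i-d_i),$$ where the minimum is over integers $m$.
   Context: All graphs are finite and simple. The Laplacian eigenvalues of $G=(V,E)$ are the eigenvalues (with multiplicity) of $L=D-A$, where $D$ is the diagonal matrix of vertex degrees and $A$ is the adjacency matrix. For $U\subset V$, $\overline{U}=V\setminus U$, and $\partial(U,\overline{U})$ is the set of edges connecting a vertex of $U$ with a vertex of $\overline{U}$. The isoperimetric number is $$i(G)=\min_{U\subset V}\left\{\frac{|\partial(U,\overline{U})|}{|U|} : 0<|U|\le \frac{n}{2}\right\}.$$ *)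

theory Defs
  imports "Jordan_Normal_Form.Char_Poly" "HOL-Library.Multiset"
begin

locale simple_graph =
  fixes V :: "'a set" and E :: "'a set set"
  assumes finite_vertices: "finite V"
    and edges: "\<And>e. e \<in> E \<Longrightarrow> e \<subseteq> V \<and> card e = 2"

definition degree_of :: "'a set set \<Rightarrow> 'a \<Rightarrow> nat" where
  "degree_of E v = card {e \<in> E. v \<in> e}"

definition edge_boundary :: "'a set \<Rightarrow> 'a set set \<Rightarrow> 'a set \<Rightarrow> 'a set set" where
  "edge_boundary V E U = {e \<in> E. \<exists>u \<in> U. \<exists>w \<in> V - U. e = {u, w}}"

text \<open>The minimum ranges over a nonempty set exactly when \<open>card V \<ge> 2\<close>.\<close>

definition isoperimetric_number :: "'a set \<Rightarrow> 'a set set \<Rightarrow> real" where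
  "isoperimetric_number V E =
     Min ((\<lambda>U. real (card (edge_boundary V E U)) / real (card U)) `
            {U. U \<subseteq> V \<and> 0 < card U \<and> real (card U) \<le> real (card V) / 2})"

text \<open>Matrices are indexed by natural numbers, so the rows and columns of \<open>D\<close> and \<open>A\<close> are
  labelled by a list \<open>vs\<close> enumerating the vertices without repetition, in any order.\<close>

definition degree_matrix :: "'a list \<Rightarrow> 'a set set \<Rightarrow> real mat" where
  "degree_matrix vs E = mat (length vs) (length vs)
     (\<lambda>(i, j). if i = j then real (degree_of E (vs ! i)) else 0)"

definition adjacency_matrix :: "'a list \<Rightarrow> 'a set set \<Rightarrow> real mat" where
  "adjacency_matrix vs E = mat (length vs) (length vs)
     (\<lambda>(i, j). if {vs ! i, vs ! j} \<in> E then 1 else 0)"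

definition laplacian :: "'a list \<Rightarrow> 'a set set \<Rightarrow> real mat" where
  "laplacian vs E = degree_matrix vs E - adjacency_matrix vs E"

text \<open>Both sequences below are weakly decreasing and indexed from \<open>0\<close>. The eigenvalues are the
  real roots of the characteristic polynomial with their multiplicities; there are \<open>card V\<close> of
  them, because the Laplacian is symmetric (\<open>length_laplacian_eigenvalues\<close>).\<close>

definition laplacian_eigenvalues :: "'a list \<Rightarrow> 'a set set \<Rightarrow> real list" where
  "laplacian_eigenvalues vs E =
     rev (sorted_list_of_multiset (proots (char_poly (laplacian vs E))))"

definition degree_sequence :: "'a list \<Rightarrow> 'a set set \<Rightarrow> nat list" where
  "degree_sequence vs E = rev (sort (map (degree_of E) vs))"

lemma laplacian_carrier: "laplacian vs E \<in> carrier_mat (length vs) (length vs)"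
  by (simp add: laplacian_def degree_matrix_def adjacency_matrix_def minus_carrier_mat)

lemma laplacian_symmetric:
  assumes "i < length vs" "j < length vs"
  shows "laplacian vs E $$ (i, j) = laplacian vs E $$ (j, i)"
  using assms
  by (simp add: laplacian_def degree_matrix_def adjacency_matrix_def insert_commute)

lemma symmetric_eigenvalue_real:
  fixes A :: "real mat" and k :: complex
  assumes A: "A \<in> carrier_mat n n"
    and sym: "\<And>i j. i < n \<Longrightarrow> j < n \<Longrightarrow> A $$ (i, j) = A $$ (j, i)"
    and ev: "eigenvalue (map_mat complex_of_real A) k"
  shows "k \<in> \<real>"
proof -
  from ev A obtain v where v: "v \<in> carrier_vec n" "v \<noteq> 0\<^sub>v n"
    and Av: "map_mat complex_of_real A *\<^sub>v v = k \<cdot>\<^sub>v v"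
    by (auto simp: eigenvalue_def eigenvector_def)
  have row: "(\<Sum>j<n. of_real (A $$ (i, j)) * v $ j) = k * v $ i" if "i < n" for i
  proof -
    have "(map_mat complex_of_real A *\<^sub>v v) $ i = (k \<cdot>\<^sub>v v) $ i" using Av by simp
    moreover have "(map_mat complex_of_real A *\<^sub>v v) $ i
        = (\<Sum>j<n. of_real (A $$ (i, j)) * v $ j)"
      using that A v by (auto simp: scalar_prod_def atLeast0LessThan intro!: sum.cong)
    ultimately show ?thesis using that v by simp
  qed
  define S where "S = (\<Sum>i<n. \<Sum>j<n. cnj (v $ i) * of_real (A $$ (i, j)) * v $ j)"
  define N where "N = (\<Sum>i<n. (cmod (v $ i))\<^sup>2)"
  have SN: "S = k * of_real N"
  proof -
    have "S = (\<Sum>i<n. cnj (v $ i) * (\<Sum>j<n. of_real (A $$ (i, j)) * v $ j))"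
      by (simp add: S_def sum_distrib_left mult.assoc)
    also have "\<dots> = (\<Sum>i<n. cnj (v $ i) * (k * v $ i))" using row by simp
    also have "\<dots> = (\<Sum>i<n. k * of_real ((cmod (v $ i))\<^sup>2))"
      by (intro sum.cong refl) (simp only: complex_norm_square mult_ac)
    finally show ?thesis by (simp add: N_def sum_distrib_left)
  qed
  have "cnj S = (\<Sum>i<n. \<Sum>j<n. cnj (v $ j) * of_real (A $$ (i, j)) * v $ i)"
    by (simp add: S_def mult_ac)
  also have "\<dots> = (\<Sum>j<n. \<Sum>i<n. cnj (v $ j) * of_real (A $$ (i, j)) * v $ i)"
    by (rule sum.swap)
  also have "\<dots> = S" unfolding S_def using sym by (intro sum.cong refl) simp
  finally have "cnj k * of_real N = k * of_real N" by (simp add: SN)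
  moreover have "N \<noteq> 0"
  proof
    assume "N = 0"
    hence "v $ i = 0" if "i < n" for i
      using that by (auto simp: N_def sum_nonneg_eq_0_iff)
    hence "v = 0\<^sub>v n" using v by (intro eq_vecI) auto
    thus False using v by simp
  qed
  ultimately have "cnj k = k" by simp
  thus ?thesis by (simp add: Reals_cnj_iff)
qed

lemma size_proots_real_rooted:
  fixes p :: "real poly"
  assumes "p \<noteq> 0"
    and "\<And>z. poly (map_poly complex_of_real p) z = 0 \<Longrightarrow> z \<in> \<real>"
  shows "size (proots p) = degree p"
  using assms
proof (induction "degree p" arbitrary: p)
  case 0
  then obtain c where "p = [:c:]" by (metis degree_eq_zeroE)
  thus ?case by simp
next
  case (Suc d)
  have "\<not> constant (poly (map_poly complex_of_real p))"
    using Suc.hyps(2) by (simp add: constant_degree)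
  then obtain z where z: "poly (map_poly complex_of_real p) z = 0"
    using fundamental_theorem_of_algebra by blast
  then obtain r where r: "z = of_real r" using Suc.prems(2) by (auto elim: Reals_cases)
  have "complex_of_real (poly p r) = 0" using z unfolding r by simp
  hence "poly p r = 0" by simp
  then obtain q where q: "p = [:-r, 1:] * q" by (auto simp: poly_eq_0_iff_dvd)
  have q0: "q \<noteq> 0" using Suc.prems q by auto
  have deg: "degree p = Suc (degree q)" using q0 by (simp add: q degree_mult_eq del: mult_pCons_left)
  have "size (proots q) = degree q"
  proof (rule Suc.hyps(1))
    show "d = degree q" using deg Suc.hyps(2) by simp
    show "q \<noteq> 0" by fact
    interpret hom: map_poly_comm_ring_hom complex_of_real ..
    fix w assume "poly (map_poly complex_of_real q) w = 0"
    hence "poly (map_poly complex_of_real p) w = 0"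
      unfolding q hom.hom_mult poly_mult by simp
    thus "w \<in> \<real>" by (rule Suc.prems(2))
  qed
  moreover have "proots p = {#r#} + proots q"
    unfolding q using q0 by (subst proots_mult) auto
  ultimately show ?case using deg by simp
qed

lemma length_laplacian_eigenvalues: "length (laplacian_eigenvalues vs E) = length vs"
proof -
  let ?L = "laplacian vs E"
  note L = laplacian_carrier[of vs E]
  have "size (proots (char_poly ?L)) = degree (char_poly ?L)"
  proof (rule size_proots_real_rooted)
    show "char_poly ?L \<noteq> 0" using degree_monic_char_poly[OF L] by auto
    fix z assume "poly (map_poly complex_of_real (char_poly ?L)) z = 0"
    hence "poly (char_poly (map_mat complex_of_real ?L)) z = 0"
      using of_real_hom.char_poly_hom[OF L, where 'a = complex] by simp
    hence "eigenvalue (map_mat complex_of_real ?L) z"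
      using L eigenvalue_root_char_poly[of "map_mat complex_of_real ?L" "length vs" z] by simp
    thus "z \<in> \<real>" using symmetric_eigenvalue_real[OF L laplacian_symmetric] by blast
  qed
  also have "degree (char_poly ?L) = length vs" using degree_monic_char_poly[OF L] by simp
  finally show ?thesis by (simp add: laplacian_eigenvalues_def flip: size_mset)
qed

end

theory Submission
  imports Defs "HOL-Combinatorics.Permutations" "HOL-Analysis.Convex"
begin

text \<open>Let \<open>W\<close> consist of \<open>m\<close> vertices of largest degree and let \<open>U\<close> be the set of the other \<open>n - m\<close>
  vertices. As \<open>n / 2 \<le> m < n\<close>, the set \<open>U\<close> competes in the minimum that defines the isoperimetric number, so
  it suffices to show that the \<open>m\<close> largest Laplacian eigenvalues sum to at least the degree sum of \<open>W\<close>
  plus \<open>\<bar>\<partial>U\<bar> / \<bar>U\<bar>\<close>.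

  By Ky Fan's principle it is enough to exhibit an \<open>m\<close>-dimensional space on which the Laplacian \<open>L\<close> has
  this number as the trace of its compression. Take the vectors that are constant on \<open>U\<close> and orthogonal to the
  all-ones vector. Together with the all-ones vector they span all vectors that are constant on \<open>U\<close>, a space
  with orthonormal basis the unit vectors of \<open>W\<close> and the normalized indicator of \<open>U\<close>. The unit vectors
  contribute the degrees, the indicator contributes \<open>\<bar>\<partial>U\<bar> / \<bar>U\<bar>\<close>, and the all-ones vector, being in the
  kernel of \<open>L\<close>, accounts for \<open>0\<close> of the total.

  No basis of the subspace is ever constructed. The squared length of the projection to it is an explicit
  quadratic form (\<open>projection_form\<close>); its values on an orthonormal eigenbasis lie in \<open>[0, 1]\<close> and sum to \<open>m\<close>,
  and weighting the eigenvalues by these values yields the trace of the compression (\<open>sum_projection_form\<close>).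
  Such weights are best placed on the largest eigenvalues (\<open>weighted_sum_le_sum_of_largest\<close>). The eigenbasis,
  with multiplicities matching the roots of the characteristic polynomial, comes from
  \<open>real_symmetric_orthogonal_diagonalization\<close>.\<close>

text \<open>The symbol \<open>\<bullet>\<close> denotes the scalar product of vectors given by a list of coordinates.\<close>

unbundle no inner_syntax

section \<open>Orthogonal diagonalization of real symmetric matrices\<close>

text \<open>The witness is the Householder matrix \<open>1 - 2 u u\<^sup>T / (u \<bullet> u)\<close> for \<open>u = v - e\<^sub>0\<close>, the reflection in the
  hyperplane that bisects the angle between the unit vectors \<open>e\<^sub>0\<close> and \<open>v\<close>. It extends \<open>v\<close> to an orthonormal basis by a
  closed formula, and because it is a symmetric involution it serves as its own transpose and inverse.\<close>

lemma householder_reflection: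
  fixes v :: "real vec"
  assumes v: "v \<in> carrier_vec n" and n: "0 < n" and unit: "v \<bullet> v = 1"
  obtains H where "H \<in> carrier_mat n n" "transpose_mat H = H" "H * H = 1\<^sub>m n" "col H 0 = v"
proof -
  define u where "u i = v $ i - (if i = 0 then 1 else 0)" for i
  define q where "q = (\<Sum>i<n. u i * u i)"
  \<comment> \<open>If \<open>v = e\<^sub>0\<close> then \<open>q = 0\<close>, so \<open>c = 2 / 0 = 0\<close> and the formula gives the identity, as it should.\<close>
  define c where "c = 2 / q"
  define H where "H = mat n n (\<lambda>(i, j). (if i = j then 1 else 0) - c * u i * u j)"
  have vv: "(\<Sum>i<n. v $ i * v $ i) = 1"
    using unit v by (simp add: scalar_prod_def atLeast0LessThan)
  have "q = (\<Sum>i<n. v $ i * v $ i - 2 * (if i = 0 then v $ i else 0) + (if i = 0 then 1 else 0))"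
    unfolding q_def u_def by (intro sum.cong) (auto simp: algebra_simps)
  also have "\<dots> = 2 - 2 * v $ 0"
    using n vv by (simp add: sum.distrib sum_subtractf flip: sum_distrib_left)
  finally have q: "q = - 2 * u 0" by (simp add: u_def)
  have u0: "u i = 0" if "q = 0" "i < n" for i
    using that sum_nonneg_eq_0_iff[of "{..<n}" "\<lambda>i. u i * u i"] by (auto simp: q_def)
  \<comment> \<open>This is all that both claims below use about \<open>c\<close>; it avoids treating \<open>q = 0\<close> separately.\<close>
  have cq: "c * u i * q = 2 * u i" if "i < n" for i
    using u0[OF _ that] by (cases "q = 0") (auto simp: c_def)
  have H: "H \<in> carrier_mat n n" by (simp add: H_def)
  have "transpose_mat H = H" by (rule eq_matI) (auto simp: H_def)
  moreover have "H * H = 1\<^sub>m n"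
  proof (rule eq_matI)
    fix i j assume "i < dim_row (1\<^sub>m n)" "j < dim_col (1\<^sub>m n)"
    hence ij: "i < n" "j < n" by auto
    have "(H * H) $$ (i, j) = (\<Sum>k<n. ((if i = k then 1 else 0) - c * u i * u k)
        * ((if k = j then 1 else 0) - c * u k * u j))"
      using ij by (simp add: H_def scalar_prod_def atLeast0LessThan)
    also have "\<dots> = (\<Sum>k<n. (if k = i then (if i = j then 1 else 0) - c * u i * u j else 0)
        - (if k = j then c * u i * u j else 0) + c * u i * (c * u j) * (u k * u k))"
      by (intro sum.cong) (auto simp: algebra_simps)
    also have "\<dots> = (if i = j then 1 else 0) - 2 * (c * u i * u j) + c * u i * (c * u j) * q"
      using ij by (simp add: sum.distrib sum_subtractf q_def flip: sum_distrib_left)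
    also have "c * u i * (c * u j) * q = 2 * (c * u i * u j)"
      using cq[OF ij(2)] by (simp add: algebra_simps)
    finally show "(H * H) $$ (i, j) = 1\<^sub>m n $$ (i, j)" using ij by simp
  qed (use H in auto)
  moreover have "col H 0 = v"
  proof (rule eq_vecI)
    fix i assume "i < dim_vec v"
    hence i: "i < n" using v by simp
    have "c * u i * u 0 = - u i" using cq[OF i] by (simp add: q algebra_simps)
    thus "col H 0 $ i = v $ i" using i n by (auto simp: H_def u_def)
  qed (use v in \<open>simp add: H_def\<close>)
  ultimately show ?thesis using H that by blast
qed

lemma unit_eigenvector_exists:
  fixes A :: "real mat"
  assumes A: "A \<in> carrier_mat n n" and e: "poly (char_poly A) e = 0"
  obtains v where "v \<in> carrier_vec n" "v \<bullet> v = 1" "A *\<^sub>v v = e \<cdot>\<^sub>v v"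
proof -
  from e A obtain w where w: "w \<in> carrier_vec n" "w \<noteq> 0\<^sub>v n" "A *\<^sub>v w = e \<cdot>\<^sub>v w"
    using eigenvalue_root_char_poly[OF A] by (auto simp: eigenvalue_def eigenvector_def)
  have ww: "w \<bullet> w > 0"
    using w conjugate_square_greater_0_vec[of w n] by simp
  define v where "v = (1 / sqrt (w \<bullet> w)) \<cdot>\<^sub>v w"
  have "v \<in> carrier_vec n" using w by (simp add: v_def)
  moreover have "v \<bullet> v = 1" using w ww by (simp add: v_def)
  moreover have "A *\<^sub>v v = e \<cdot>\<^sub>v v"
    using w A by (simp add: v_def mult_mat_vec smult_smult_assoc mult.commute)
  ultimately show ?thesis using that by blast
qed

text \<open>The induction deflates one eigenvalue at a time. A reflection \<open>H\<close> that moves a unit eigenvector to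
  the first basis vector turns \<open>A\<close> into \<open>H A H\<close>, whose first column is a multiple of the first basis
  vector; by symmetry so is its first row, and a smaller symmetric block remains. The eigenvalues are
  prescribed as a multiset of roots, in any order, because dividing the characteristic polynomial by a
  linear factor removes exactly one copy of its root.\<close>

theorem real_symmetric_orthogonal_diagonalization:
  fixes A :: "real mat"
  assumes "A \<in> carrier_mat n n" and "transpose_mat A = A"
    and "mset es = proots (char_poly A)" and "length es = n"
  shows "\<exists>P \<in> carrier_mat n n. P * transpose_mat P = 1\<^sub>m n
    \<and> A = P * mat_diag n ((!) es) * transpose_mat P"
  using assms
proof (induction es arbitrary: n A)
  case Nil
  thus ?case by (intro bexI[of _ "1\<^sub>m 0"]) (auto intro!: eq_matI)
next
  case (Cons e es)
  note A = Cons.prems(1) and sym = Cons.prems(2)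
  define k where "k = length es"
  have n: "n = Suc k" using Cons.prems(4) by (simp add: k_def)
  have cp0: "char_poly A \<noteq> 0" using degree_monic_char_poly[OF A] by auto
  have "e \<in># proots (char_poly A)" by (simp flip: Cons.prems(3))
  hence "poly (char_poly A) e = 0" using cp0 by simp
  then obtain v where v: "v \<in> carrier_vec n" "v \<bullet> v = 1" "A *\<^sub>v v = e \<cdot>\<^sub>v v"
    using unit_eigenvector_exists[OF A] by blast
  obtain H where H: "H \<in> carrier_mat n n" and Ht: "transpose_mat H = H" and HH: "H * H = 1\<^sub>m n"
    and H0: "col H 0 = v"
    using householder_reflection[OF v(1) _ v(2)] n by blast
  define B where "B = H * A * H"
  have B: "B \<in> carrier_mat n n" using H A by (simp add: B_def)
  have Bsym: "transpose_mat B = B"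
    using H A by (simp add: B_def transpose_mult[of _ n n _ n] Ht sym)
  have HB: "H * B * H = A"
  proof -
    have "H * B * H = (H * H) * A * (H * H)" using H A by (simp add: B_def assoc_mult_mat[of _ n n _ n _ n])
    thus ?thesis using A by (simp add: HH)
  qed
  have Hv: "H *\<^sub>v v = col (1\<^sub>m n) 0"
    using H H0 n col_mult2[OF H H, of 0] by (simp add: HH)
  have "col B 0 = H *\<^sub>v (A *\<^sub>v v)"
    using H A n by (simp add: B_def H0 col_mult2[of _ n n _ n] assoc_mult_mat[of _ n n _ n _ n] mult_mat_vec_def)
  also have "\<dots> = e \<cdot>\<^sub>v unit_vec n 0" using v H Hv n by (simp add: mult_mat_vec[OF H])
  finally have colB: "col B 0 = e \<cdot>\<^sub>v unit_vec n 0" .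
  have Bi0: "B $$ (i, 0) = (if i = 0 then e else 0)" if "i < n" for i
    using arg_cong[OF colB, of "\<lambda>w. w $ i"] that B n by auto
  have B0i: "B $$ (0, i) = (if i = 0 then e else 0)" if "i < n" for i
    using Bi0[OF that] arg_cong[OF Bsym, of "\<lambda>M. M $$ (i, 0)"] that B n by auto
  define C where "C = mat k k (\<lambda>(i, j). B $$ (Suc i, Suc j))"
  define Me where "Me = mat 1 1 (\<lambda>_. e)"
  have C: "C \<in> carrier_mat k k" by (simp add: C_def)
  have Me: "Me \<in> carrier_mat 1 1" by (simp add: Me_def)
  have blocks: "B = four_block_mat Me (0\<^sub>m 1 k) (0\<^sub>m k 1) C"
    by (rule eq_matI) (use B n Bi0 B0i in \<open>auto simp: Me_def C_def less_Suc_eq_0_disj\<close>)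
  have "transpose_mat C = C"
  proof (rule eq_matI)
    fix i j assume "i < dim_row C" "j < dim_col C"
    thus "transpose_mat C $$ (i, j) = C $$ (i, j)"
      using arg_cong[OF Bsym, of "\<lambda>M. M $$ (Suc i, Suc j)"] B n by (auto simp: C_def)
  qed (auto simp: C_def)
  moreover have "mset es = proots (char_poly C)"
  proof -
    have "similar_mat A B"
      by (rule similar_matI[of _ _ H H n]) (use A B H HH HB in auto)
    hence "char_poly A = char_poly Me * char_poly C"
      using char_poly_four_block_zeros_col[OF Me _ C] by (simp add: char_poly_similar blocks)
    also have "char_poly Me = [:- e, 1:]"
      by (simp add: Me_def char_poly_defs det_single)
    finally have "char_poly A = [:- e, 1:] * char_poly C" .
    moreover have "char_poly C \<noteq> 0" using degree_monic_char_poly[OF C] by auto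
    ultimately have "proots (char_poly A) = {#e#} + proots (char_poly C)"
      by (simp only:) (subst proots_mult, auto)
    thus ?thesis using Cons.prems(3) by simp
  qed
  ultimately obtain Q where Q: "Q \<in> carrier_mat k k" and QQ: "Q * transpose_mat Q = 1\<^sub>m k"
    and CQ: "C = Q * mat_diag k ((!) es) * transpose_mat Q"
    using Cons.IH[OF C] k_def by blast
  define F where "F = four_block_mat (1\<^sub>m 1) (0\<^sub>m 1 k) (0\<^sub>m k 1) Q"
  define D where "D = mat_diag n ((!) (e # es))"
  have F: "F \<in> carrier_mat n n" using Q n by (auto simp: F_def)
  have D: "D \<in> carrier_mat n n" by (simp add: D_def)
  have Dk: "mat_diag k ((!) es) \<in> carrier_mat k k" by simp
  have Ft: "transpose_mat F = four_block_mat (1\<^sub>m 1) (0\<^sub>m 1 k) (0\<^sub>m k 1) (transpose_mat Q)"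
    unfolding F_def by (subst transpose_four_block_mat[OF one_carrier_mat zero_carrier_mat zero_carrier_mat Q]) auto
  have Qt: "transpose_mat Q \<in> carrier_mat k k" using Q by simp
  note z = one_carrier_mat zero_carrier_mat zero_carrier_mat
  have FF: "F * transpose_mat F = 1\<^sub>m n"
    unfolding Ft unfolding F_def
    by (subst mult_four_block_mat[OF z Q z Qt]) (use Q n in \<open>simp add: QQ\<close>)
  have Deq: "D = four_block_mat Me (0\<^sub>m 1 k) (0\<^sub>m k 1) (mat_diag k ((!) es))"
    by (rule eq_matI) (use n in \<open>auto simp: D_def Me_def mat_diag_def less_Suc_eq_0_disj\<close>)
  have FD: "F * D = four_block_mat Me (0\<^sub>m 1 k) (0\<^sub>m k 1) (Q * mat_diag k ((!) es))"
    unfolding F_def Deq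
    by (subst mult_four_block_mat[OF z Q Me zero_carrier_mat zero_carrier_mat Dk])
       (use Q Me in \<open>simp add: left_mult_zero_mat[OF Dk] right_mult_zero_mat[OF Q]\<close>)
  have QD: "Q * mat_diag k ((!) es) \<in> carrier_mat k k" by (rule mult_carrier_mat[OF Q Dk])
  have FDF: "F * D * transpose_mat F = B"
    unfolding FD Ft blocks CQ
    by (subst mult_four_block_mat[OF Me zero_carrier_mat zero_carrier_mat _ z Qt, of _ k])
       (use Q Qt Me QD in \<open>auto simp: right_mult_zero_mat[OF QD]\<close>)
  have Ftc: "transpose_mat F \<in> carrier_mat n n" using F by simp
  have PT: "transpose_mat (H * F) = transpose_mat F * H"
    using transpose_mult[OF H F] Ht by simp
  have "H * F * transpose_mat (H * F) = H * (F * transpose_mat F) * H"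
    unfolding PT using H F Ftc by (simp add: assoc_mult_mat[of _ n n _ n _ n])
  also have "\<dots> = 1\<^sub>m n" using H by (simp add: FF HH)
  finally have 1: "H * F * transpose_mat (H * F) = 1\<^sub>m n" .
  have "H * F * D * transpose_mat (H * F) = H * (F * D * transpose_mat F) * H"
    unfolding PT using H F Ftc D by (simp add: assoc_mult_mat[of _ n n _ n _ n])
  also have "\<dots> = A" by (simp add: FDF HB)
  finally have 2: "A = H * F * D * transpose_mat (H * F)" by simp
  show ?case
    using 1 2 H F unfolding D_def by (intro bexI[of _ "H * F"]) auto
qed

text \<open>The diagonalization in coordinates, with \<open>x i\<close> the \<open>i\<close>-th eigenvector. The normalization comes from
  the columns of the orthogonal matrix, the completeness relation in the second fact from its rows;
  through the latter the eigenbasis disappears again from trace computations.\<close>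

lemma real_symmetric_spectral_expansion:
  fixes A :: "real mat"
  assumes A: "A \<in> carrier_mat n n" and sym: "transpose_mat A = A"
    and es: "mset es = proots (char_poly A)" "length es = n"
  obtains x :: "nat \<Rightarrow> nat \<Rightarrow> real" where
    "\<And>i. i < n \<Longrightarrow> (\<Sum>s<n. (x i s)\<^sup>2) = 1"
    "\<And>s t. s < n \<Longrightarrow> t < n \<Longrightarrow> (\<Sum>i<n. x i s * x i t) = (if s = t then 1 else 0)"
    "\<And>s t. s < n \<Longrightarrow> t < n \<Longrightarrow> A $$ (s, t) = (\<Sum>i<n. es ! i * (x i s * x i t))"
proof -
  obtain P where P: "P \<in> carrier_mat n n" and PP: "P * transpose_mat P = 1\<^sub>m n"
    and AP: "A = P * mat_diag n ((!) es) * transpose_mat P"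
    using real_symmetric_orthogonal_diagonalization[OF assms] by blast
  have Pt: "transpose_mat P \<in> carrier_mat n n" using P by simp
  have PP': "transpose_mat P * P = 1\<^sub>m n" by (rule mat_mult_left_right_inverse[OF P Pt PP])
  show ?thesis
  proof
    fix i assume "i < n"
    thus "(\<Sum>s<n. (P $$ (s, i))\<^sup>2) = 1"
      using arg_cong[OF PP', of "\<lambda>M. M $$ (i, i)"] P
      by (simp add: scalar_prod_def atLeast0LessThan power2_eq_square)
  next
    fix s t assume st: "s < n" "t < n"
    thus "(\<Sum>i<n. P $$ (s, i) * P $$ (t, i)) = (if s = t then 1 else 0)"
      using arg_cong[OF PP, of "\<lambda>M. M $$ (s, t)"] P
      by (simp add: scalar_prod_def atLeast0LessThan)
    show "A $$ (s, t) = (\<Sum>i<n. es ! i * (P $$ (s, i) * P $$ (t, i)))"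
      unfolding AP mat_diag_mult_right[OF P] using st P
      by (simp add: scalar_prod_def atLeast0LessThan mult_ac)
  qed
qed

section \<open>A trace inequality for symmetric matrices with zero row sums\<close>

text \<open>Weights in \<open>[0, 1]\<close> of total \<open>m\<close> do best when they are concentrated on the \<open>m\<close> largest entries.
  Subtracting the pivot \<open>es ! m\<close> from all entries makes the comparison hold term by term: the first
  \<open>m\<close> differences are nonnegative and the remaining ones are not positive.\<close>

lemma weighted_sum_le_sum_of_largest:
  fixes es :: "real list" and b :: "nat \<Rightarrow> real"
  assumes desc: "sorted_wrt (\<ge>) es" and m: "m < length es"
    and b0: "\<And>i. i < length es \<Longrightarrow> 0 \<le> b i" and b1: "\<And>i. i < length es \<Longrightarrow> b i \<le> 1"
    and bsum: "(\<Sum>i<length es. b i) = real m"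
  shows "(\<Sum>i<length es. es ! i * b i) \<le> (\<Sum>i<m. es ! i)"
proof -
  let ?n = "length es" and ?c = "es ! m"
  have "(es ! i - ?c) * b i \<le> (if i < m then es ! i - ?c else 0)" if i: "i < ?n" for i
  proof (cases "i < m")
    case True
    hence "es ! i \<ge> ?c" using sorted_wrt_nth_less[OF desc, of i m] m by simp
    thus ?thesis using True mult_left_le[OF b1[OF i], of "es ! i - ?c"] by simp
  next
    case False
    hence "es ! i \<le> ?c" using sorted_wrt_nth_less[OF desc, of m i] i by (cases "i = m") auto
    thus ?thesis using False b0[OF i] by (simp add: mult_nonpos_nonneg)
  qed
  hence "(\<Sum>i<?n. (es ! i - ?c) * b i) \<le> (\<Sum>i<?n. if i < m then es ! i - ?c else 0)"
    by (intro sum_mono) simp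
  also have "\<dots> = (\<Sum>i<m. es ! i - ?c)"
    using m by (intro sum.mono_neutral_cong_right) auto
  finally show ?thesis
    by (simp add: left_diff_distrib sum_subtractf bsum flip: sum_distrib_left)
qed

text \<open>The difference of the two sides is a multiple of \<open>(a / p - b / q)\<^sup>2\<close>.\<close>

lemma square_sum_div_le:
  fixes a b p q :: real
  assumes "0 < p" "0 < q"
  shows "(a + b)\<^sup>2 / (p + q) \<le> a\<^sup>2 / p + b\<^sup>2 / q"
proof -
  have "(a / p - b / q)\<^sup>2 * (p * q) = (a\<^sup>2 / p + b\<^sup>2 / q) * (p + q) - (a + b)\<^sup>2"
    using assms by (simp add: field_simps power2_eq_square)
  moreover have "0 \<le> (a / p - b / q)\<^sup>2 * (p * q)" using assms by simp
  ultimately show ?thesis using assms by (simp add: pos_divide_le_eq)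
qed

text \<open>For disjoint nonempty \<open>J\<close> and \<open>S\<close>, this is the squared length of the orthogonal projection of \<open>x\<close> to
  the vectors that are constant on \<open>S\<close> and have coordinate sum \<open>0\<close>. The first two terms come from the
  space of vectors constant on \<open>S\<close>; the last one removes the direction of the all-ones vector, which
  lies in that space. The dimension is \<open>card J + 1 - 1 = card J\<close>.\<close>

definition projection_form :: "'b set \<Rightarrow> 'b set \<Rightarrow> ('b \<Rightarrow> real) \<Rightarrow> real" where
  "projection_form J S x = (\<Sum>s\<in>J. (x s)\<^sup>2) + (\<Sum>s\<in>S. x s)\<^sup>2 / card S
     - (\<Sum>s\<in>J \<union> S. x s)\<^sup>2 / card (J \<union> S)"

text \<open>A projection shortens vectors, but the closed formula makes both bounds elementary. For the lower one,
  \<open>square_sum_div_le\<close> splits the last term into contributions of \<open>J\<close> and \<open>S\<close>, of which the second cancels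
  and the first is absorbed by the Cauchy-Schwarz inequality; for the upper one, the last term is dropped
  and Cauchy-Schwarz is applied on \<open>S\<close>.\<close>

lemma projection_form_bounds:
  assumes fin: "finite J" "finite S" and ne: "J \<noteq> {}" "S \<noteq> {}" and disj: "J \<inter> S = {}"
  shows "0 \<le> projection_form J S x" and "projection_form J S x \<le> (\<Sum>s\<in>J \<union> S. (x s)\<^sup>2)"
proof -
  have pos: "0 < real (card J)" "0 < real (card S)" using fin ne by (auto simp: card_gt_0_iff)
  have cs: "(\<Sum>s\<in>T. x s)\<^sup>2 / card T \<le> (\<Sum>s\<in>T. (x s)\<^sup>2)" if "0 < real (card T)" for T
    using sum_squared_le_sum_of_squares[of x T] that by (simp add: divide_le_eq)
  have "(\<Sum>s\<in>J \<union> S. x s)\<^sup>2 / card (J \<union> S) \<le> (\<Sum>s\<in>J. x s)\<^sup>2 / card J + (\<Sum>s\<in>S. x s)\<^sup>2 / card S"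
    using square_sum_div_le[OF pos] fin disj by (simp add: sum.union_disjoint card_Un_disjoint)
  with cs[OF pos(1)] show "0 \<le> projection_form J S x" by (simp add: projection_form_def)
  have "0 \<le> (\<Sum>s\<in>J \<union> S. x s)\<^sup>2 / card (J \<union> S)" by simp
  moreover have "(\<Sum>s\<in>J \<union> S. (x s)\<^sup>2) = (\<Sum>s\<in>J. (x s)\<^sup>2) + (\<Sum>s\<in>S. (x s)\<^sup>2)"
    by (rule sum.union_disjoint) (use fin disj in auto)
  ultimately show "projection_form J S x \<le> (\<Sum>s\<in>J \<union> S. (x s)\<^sup>2)"
    using cs[OF pos(2)] unfolding projection_form_def by linarith
qed

text \<open>The right-hand side is the trace of the product of \<open>M\<close> with the projection matrix. For an
  orthonormal eigenbasis \<open>x\<close> of a symmetric matrix, weights \<open>1\<close> make \<open>M\<close> the identity and the value the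
  rank of the projection, while the eigenvalues as weights make \<open>M\<close> the matrix itself and the value the
  trace of its compression.\<close>

lemma sum_projection_form:
  fixes x :: "nat \<Rightarrow> 'b \<Rightarrow> real" and w :: "nat \<Rightarrow> real"
  assumes M: "\<And>s t. s \<in> J \<union> S \<Longrightarrow> t \<in> J \<union> S \<Longrightarrow> (\<Sum>i<n. w i * (x i s * x i t)) = M s t"
  shows "(\<Sum>i<n. w i * projection_form J S (x i)) = (\<Sum>s\<in>J. M s s)
    + (\<Sum>s\<in>S. \<Sum>t\<in>S. M s t) / card S - (\<Sum>s\<in>J \<union> S. \<Sum>t\<in>J \<union> S. M s t) / card (J \<union> S)"
proof -
  have sq: "(\<Sum>i<n. w i * (\<Sum>s\<in>T. x i s)\<^sup>2) = (\<Sum>s\<in>T. \<Sum>t\<in>T. M s t)" if T: "T \<subseteq> J \<union> S" for T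
  proof -
    have "(\<Sum>i<n. w i * (\<Sum>s\<in>T. x i s)\<^sup>2) = (\<Sum>i<n. \<Sum>s\<in>T. \<Sum>t\<in>T. w i * (x i s * x i t))"
      by (simp only: power2_eq_square sum_product) (simp only: sum_distrib_left)
    also have "\<dots> = (\<Sum>s\<in>T. \<Sum>i<n. \<Sum>t\<in>T. w i * (x i s * x i t))" by (rule sum.swap)
    also have "\<dots> = (\<Sum>s\<in>T. \<Sum>t\<in>T. \<Sum>i<n. w i * (x i s * x i t))"
      by (intro sum.cong refl sum.swap)
    also have "\<dots> = (\<Sum>s\<in>T. \<Sum>t\<in>T. M s t)" using T by (intro sum.cong refl M) auto
    finally show ?thesis .
  qed
  have "(\<Sum>i<n. w i * (\<Sum>s\<in>J. (x i s)\<^sup>2)) = (\<Sum>s\<in>J. \<Sum>i<n. w i * (x i s * x i s))"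
    by (simp add: power2_eq_square sum_distrib_left) (rule sum.swap)
  also have "\<dots> = (\<Sum>s\<in>J. M s s)" by (intro sum.cong refl M) auto
  finally have diag: "(\<Sum>i<n. w i * (\<Sum>s\<in>J. (x i s)\<^sup>2)) = (\<Sum>s\<in>J. M s s)" .
  have "(\<Sum>i<n. w i * projection_form J S (x i)) = (\<Sum>i<n. w i * (\<Sum>s\<in>J. (x i s)\<^sup>2))
      + (\<Sum>i<n. w i * (\<Sum>s\<in>S. x i s)\<^sup>2) / card S
      - (\<Sum>i<n. w i * (\<Sum>s\<in>J \<union> S. x i s)\<^sup>2) / card (J \<union> S)"
    by (simp add: projection_form_def algebra_simps sum.distrib sum_subtractf sum_divide_distrib)
  thus ?thesis by (simp add: sq diag)
qed

text \<open>This is Ky Fan's principle, that the trace of a compression to an \<open>m\<close>-dimensional subspace is at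
  most the sum of the \<open>m\<close> largest eigenvalues, with \<open>m = card J\<close> and for the subspace of vectors that
  are constant on \<open>S\<close> and orthogonal to the all-ones vector. The quotient by \<open>card S\<close> is the Rayleigh
  quotient of the indicator of \<open>S\<close>. Removing the all-ones vector costs nothing, since the row sums
  vanish; it is what brings the dimension down from \<open>m + 1\<close> to \<open>m\<close>.\<close>

lemma trace_plus_rayleigh_quotient_le_sum_of_largest_eigenvalues:
  fixes A :: "real mat"
  assumes A: "A \<in> carrier_mat n n" and sym: "transpose_mat A = A"
    and es: "mset es = proots (char_poly A)" "length es = n" and desc: "sorted_wrt (\<ge>) es"
    and rows: "\<And>s. s < n \<Longrightarrow> (\<Sum>t<n. A $$ (s, t)) = 0"
    and JS: "J \<union> S = {..<n}" "J \<inter> S = {}" "J \<noteq> {}" "S \<noteq> {}"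
  shows "(\<Sum>j\<in>J. A $$ (j, j)) + (\<Sum>s\<in>S. \<Sum>t\<in>S. A $$ (s, t)) / card S \<le> (\<Sum>i<card J. es ! i)"
proof -
  have fin: "finite J" "finite S" using JS(1) by (metis finite_Un finite_lessThan)+
  have pos: "card J > 0" "card S > 0" using fin JS by (auto simp: card_gt_0_iff)
  have card: "card J + card S = n" using JS card_Un_disjoint[OF fin] by simp
  obtain x where unit: "\<And>i. i < n \<Longrightarrow> (\<Sum>s<n. (x i s)\<^sup>2) = 1"
    and orth: "\<And>s t. s < n \<Longrightarrow> t < n \<Longrightarrow> (\<Sum>i<n. x i s * x i t) = (if s = t then 1 else 0)"
    and exp: "\<And>s t. s < n \<Longrightarrow> t < n \<Longrightarrow> A $$ (s, t) = (\<Sum>i<n. es ! i * (x i s * x i t))"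
    using real_symmetric_spectral_expansion[OF A sym es] by blast
  define b where "b i = projection_form J S (x i)" for i
  note bounds = projection_form_bounds[OF fin JS(3,4,2)]
  have b0: "0 \<le> b i" for i using bounds(1) by (simp add: b_def)
  have b1: "b i \<le> 1" if "i < n" for i using bounds(2)[of "x i"] unit[OF that] JS(1) by (simp add: b_def)
  have lt: "s < n" if "s \<in> J \<union> S" for s using that JS(1) by auto
  have "(\<Sum>i<n. 1 * b i) = (\<Sum>s\<in>J. if s = s then 1 else 0)
      + (\<Sum>s\<in>S. \<Sum>t\<in>S. if s = t then 1 else 0) / card S
      - (\<Sum>s\<in>J \<union> S. \<Sum>t\<in>J \<union> S. if s = t then 1 else 0) / card (J \<union> S)"
    unfolding b_def by (rule sum_projection_form) (simp add: orth lt)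
  also have "\<dots> = real (card J)" using fin pos JS(4) by simp
  finally have bsum: "(\<Sum>i<n. b i) = real (card J)" by simp
  have "(\<Sum>i<n. es ! i * b i) = (\<Sum>j\<in>J. A $$ (j, j)) + (\<Sum>s\<in>S. \<Sum>t\<in>S. A $$ (s, t)) / card S
      - (\<Sum>s\<in>J \<union> S. \<Sum>t\<in>J \<union> S. A $$ (s, t)) / card (J \<union> S)"
    unfolding b_def by (rule sum_projection_form) (use exp lt in simp)
  also have "(\<Sum>s\<in>J \<union> S. \<Sum>t\<in>J \<union> S. A $$ (s, t)) = 0" unfolding JS(1) using rows by simp
  finally have "(\<Sum>j\<in>J. A $$ (j, j)) + (\<Sum>s\<in>S. \<Sum>t\<in>S. A $$ (s, t)) / card S = (\<Sum>i<n. es ! i * b i)"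
    by simp
  also have "\<dots> \<le> (\<Sum>i<card J. es ! i)"
    using weighted_sum_le_sum_of_largest[OF desc, of "card J" b] b0 b1 bsum es(2) card pos by simp
  finally show ?thesis .
qed

section \<open>Degrees and edge boundaries in the Laplacian\<close>

lemma degree_of_eq_card_neighbours:
  assumes "simple_graph V E" and v: "v \<in> V"
  shows "degree_of E v = card {w \<in> V. {v, w} \<in> E}"
proof -
  interpret simple_graph V E by fact
  have "{e \<in> E. v \<in> e} = (\<lambda>w. {v, w}) ` {w \<in> V. {v, w} \<in> E}"
  proof (intro equalityI subsetI)
    fix e assume "e \<in> {e \<in> E. v \<in> e}"
    hence e: "e \<in> E" "v \<in> e" "e \<subseteq> V" "card e = 2" using edges by auto
    then obtain w where "e = {v, w}" by (auto simp: card_2_iff doubleton_eq_iff)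
    thus "e \<in> (\<lambda>w. {v, w}) ` {w \<in> V. {v, w} \<in> E}" using e by auto
  qed auto
  moreover have "inj_on (\<lambda>w. {v, w}) A" for A by (auto simp: inj_on_def doubleton_eq_iff)
  ultimately show ?thesis by (simp add: degree_of_def card_image)
qed

text \<open>An edge of the boundary has a unique endpoint in \<open>U\<close>, so it may be counted from there.\<close>

lemma card_edge_boundary:
  assumes fin: "finite V" and U: "U \<subseteq> V"
  shows "card (edge_boundary V E U) = (\<Sum>u\<in>U. card {w \<in> V - U. {u, w} \<in> E})"
proof -
  let ?P = "SIGMA u:U. {w \<in> V - U. {u, w} \<in> E}"
  have "edge_boundary V E U = (\<lambda>(u, w). {u, w}) ` ?P"
  proof (intro equalityI subsetI)
    fix e assume "e \<in> edge_boundary V E U"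
    then obtain u w where "e \<in> E" "u \<in> U" "w \<in> V - U" "e = {u, w}"
      by (auto simp: edge_boundary_def)
    thus "e \<in> (\<lambda>(u, w). {u, w}) ` ?P" by (intro image_eqI[of _ _ "(u, w)"]) auto
  qed (auto simp: edge_boundary_def)
  moreover have "inj_on (\<lambda>(u, w). {u, w}) ?P"
    by (auto simp: inj_on_def doubleton_eq_iff)
  ultimately have "card (edge_boundary V E U) = card ?P" by (simp add: card_image)
  also have "\<dots> = (\<Sum>u\<in>U. card {w \<in> V - U. {u, w} \<in> E})"
    using fin U finite_subset[OF U fin] by (intro card_SigmaI) auto
  finally show ?thesis .
qed

lemma laplacian_row_sum:
  assumes g: "simple_graph V E" and d: "distinct vs" and V: "set vs = V" and s: "s < length vs"
  shows "(\<Sum>t<length vs. laplacian vs E $$ (s, t)) = 0"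
proof -
  have "(\<Sum>t<length vs. laplacian vs E $$ (s, t))
      = (\<Sum>t<length vs. (if s = t then real (degree_of E (vs ! s)) else 0)
          - of_bool ({vs ! s, vs ! t} \<in> E))"
    using s by (intro sum.cong) (auto simp: laplacian_def degree_matrix_def adjacency_matrix_def)
  also have "\<dots> = real (degree_of E (vs ! s)) - (\<Sum>t<length vs. of_bool ({vs ! s, vs ! t} \<in> E))"
    using s by (simp add: sum_subtractf)
  also have "(\<Sum>t<length vs. of_bool ({vs ! s, vs ! t} \<in> E)) = (\<Sum>w\<in>V. of_bool ({vs ! s, w} \<in> E) :: real)"
    using sum.reindex_bij_betw[OF bij_betw_nth[OF d refl V[symmetric]], of "\<lambda>w. of_bool ({vs ! s, w} \<in> E)"] .
  also have "\<dots> = real (degree_of E (vs ! s))"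
    using degree_of_eq_card_neighbours[OF g, of "vs ! s"] s V
    by (auto simp: Int_def)
  finally show ?thesis by simp
qed

lemma laplacian_diagonal:
  assumes "simple_graph V E" "s < length vs"
  shows "laplacian vs E $$ (s, s) = real (degree_of E (vs ! s))"
proof -
  interpret simple_graph V E by fact
  have "{vs ! s} \<notin> E" using edges[of "{vs ! s}"] by auto
  thus ?thesis using assms by (simp add: laplacian_def degree_matrix_def adjacency_matrix_def)
qed

text \<open>The rows of the Laplacian sum to zero, so its sum over \<open>S \<times> S\<close> is minus its sum over \<open>S\<close> times the
  complement, where each boundary edge occurs once with entry \<open>- 1\<close>.\<close>

lemma laplacian_sum_eq_card_edge_boundary:
  assumes g: "simple_graph V E" and d: "distinct vs" and V: "set vs = V" and S: "S \<subseteq> {..<length vs}"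
  shows "(\<Sum>s\<in>S. \<Sum>t\<in>S. laplacian vs E $$ (s, t)) = real (card (edge_boundary V E ((!) vs ` S)))"
proof -
  let ?n = "length vs" and ?L = "\<lambda>s t. laplacian vs E $$ (s, t)" and ?U = "(!) vs ` S"
  have fin: "finite V" using V by auto
  have bij: "bij_betw ((!) vs) {..<?n} V" by (rule bij_betw_nth) (use d V in auto)
  have UV: "?U \<subseteq> V" using S V by auto
  have bS: "bij_betw ((!) vs) S ?U" using bij S by (auto simp: bij_betw_def inj_on_subset)
  have bJ: "bij_betw ((!) vs) ({..<?n} - S) (V - ?U)"
    using bij S by (auto simp: bij_betw_def inj_on_subset inj_on_image_set_diff[of _ "{..<?n}"])
  have "(\<Sum>s\<in>S. \<Sum>t\<in>S. ?L s t) = (\<Sum>s\<in>S. \<Sum>t\<in>{..<?n} - S. of_bool ({vs ! s, vs ! t} \<in> E))"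
  proof (rule sum.cong[OF refl])
    fix s assume "s \<in> S"
    hence s: "s < ?n" using S by auto
    have "(\<Sum>t\<in>S. ?L s t) = - (\<Sum>t\<in>{..<?n} - S. ?L s t)"
      using laplacian_row_sum[OF g d V s] sum.subset_diff[OF S, of "?L s"] by simp
    also have "\<dots> = (\<Sum>t\<in>{..<?n} - S. of_bool ({vs ! s, vs ! t} \<in> E))"
      unfolding sum_negf[symmetric] using s \<open>s \<in> S\<close>
      by (intro sum.cong) (auto simp: laplacian_def degree_matrix_def adjacency_matrix_def)
    finally show "(\<Sum>t\<in>S. ?L s t) = (\<Sum>t\<in>{..<?n} - S. of_bool ({vs ! s, vs ! t} \<in> E))" .
  qed
  also have "\<dots> = (\<Sum>s\<in>S. \<Sum>w\<in>V - ?U. of_bool ({vs ! s, w} \<in> E))"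
    by (intro sum.cong refl sum.reindex_bij_betw[OF bJ, of "\<lambda>w. of_bool ({vs ! s, w} \<in> E)" for s])
  also have "\<dots> = (\<Sum>u\<in>?U. \<Sum>w\<in>V - ?U. of_bool ({u, w} \<in> E))"
    by (rule sum.reindex_bij_betw[OF bS])
  also have "\<dots> = real (\<Sum>u\<in>?U. card {w \<in> V - ?U. {u, w} \<in> E})"
    using fin by (simp add: sum_of_bool_eq Int_def)
  also have "\<dots> = real (card (edge_boundary V E ?U))"
    by (simp add: card_edge_boundary[OF fin UV])
  finally show ?thesis .
qed

text \<open>The sorted degrees are a permutation of the degrees, so a prefix of them is realized by distinct
  vertices.\<close>

lemma degree_sequence_prefix_index_set:
  assumes "m \<le> length vs"
  obtains J where "J \<subseteq> {..<length vs}" "card J = m"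
    "(\<Sum>i<m. degree_sequence vs E ! i) = (\<Sum>j\<in>J. degree_of E (vs ! j))"
proof -
  have "mset (degree_sequence vs E) = mset (map (degree_of E) vs)"
    by (simp add: degree_sequence_def)
  then obtain p where p: "p permutes {..<length vs}"
    and perm: "permute_list p (map (degree_of E) vs) = degree_sequence vs E"
    by (rule mset_eq_permutation) simp
  have inj: "inj_on p {..<m}" using permutes_inj_on[OF p] .
  have lt: "p i < length vs" if "i < m" for i
    using permutes_in_image[OF p, of i] that assms by simp
  have "degree_sequence vs E ! i = degree_of E (vs ! p i)" if i: "i < m" for i
  proof -
    have "degree_sequence vs E ! i = map (degree_of E) vs ! p i"
      using p i assms unfolding perm[symmetric] by (intro permute_list_nth) auto
    thus ?thesis using lt[OF i] by simp
  qed
  hence "(\<Sum>i<m. degree_sequence vs E ! i) = (\<Sum>j\<in>p ` {..<m}. degree_of E (vs ! j))"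
    by (simp add: sum.reindex[OF inj])
  moreover have "p ` {..<m} \<subseteq> {..<length vs}"
    using lt by blast
  ultimately show ?thesis using that card_image[OF inj] by simp
qed

section \<open>Eigenvalue sums and the isoperimetric number\<close>

text \<open>The graph form of the trace inequality. It sharpens, by the boundary ratio of the remaining
  vertices, the Schur-Horn bound of a sum of degrees by equally many of the largest eigenvalues.\<close>

lemma degree_sum_plus_boundary_ratio_le:
  assumes g: "simple_graph V E" and d: "distinct vs" and V: "set vs = V"
    and J: "J \<subseteq> {..<length vs}" "J \<noteq> {}" "J \<noteq> {..<length vs}"
  defines "U \<equiv> (!) vs ` ({..<length vs} - J)"
  shows "(\<Sum>j\<in>J. real (degree_of E (vs ! j))) + card (edge_boundary V E U) / card U
    \<le> (\<Sum>i<card J. laplacian_eigenvalues vs E ! i)"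
proof -
  let ?n = "length vs" and ?L = "laplacian vs E" and ?S = "{..<length vs} - J"
  have sym: "transpose_mat ?L = ?L"
    using laplacian_carrier[of vs E] laplacian_symmetric[of _ vs _ E] by (intro eq_matI) auto
  have ev: "mset (laplacian_eigenvalues vs E) = proots (char_poly ?L)"
    by (simp add: laplacian_eigenvalues_def)
  have desc: "sorted_wrt (\<ge>) (laplacian_eigenvalues vs E)"
    by (simp add: laplacian_eigenvalues_def sorted_wrt_rev)
  have "inj_on ((!) vs) ?S" by (rule inj_on_nth[OF d]) auto
  hence card: "card U = card ?S" by (simp add: U_def card_image)
  have "(\<Sum>j\<in>J. ?L $$ (j, j)) + (\<Sum>s\<in>?S. \<Sum>t\<in>?S. ?L $$ (s, t)) / card ?S
      \<le> (\<Sum>i<card J. laplacian_eigenvalues vs E ! i)"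
    by (rule trace_plus_rayleigh_quotient_le_sum_of_largest_eigenvalues[OF laplacian_carrier sym ev
          length_laplacian_eigenvalues desc laplacian_row_sum[OF g d V]]) (use J in auto)
  moreover have "(\<Sum>s\<in>?S. \<Sum>t\<in>?S. ?L $$ (s, t)) = real (card (edge_boundary V E U))"
    unfolding U_def by (rule laplacian_sum_eq_card_edge_boundary[OF g d V]) auto
  moreover have "(\<Sum>j\<in>J. ?L $$ (j, j)) = (\<Sum>j\<in>J. real (degree_of E (vs ! j)))"
    using J(1) by (intro sum.cong refl laplacian_diagonal[OF g]) auto
  ultimately show ?thesis by (simp add: card)
qed

lemma isoperimetric_number_le:
  assumes "finite V" "U \<subseteq> V" "0 < card U" "real (card U) \<le> real (card V) / 2"
  shows "isoperimetric_number V E \<le> card (edge_boundary V E U) / card U"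
  unfolding isoperimetric_number_def using assms by (intro Min_le) auto

theorem proposition4p6:
  fixes V :: "'a set" and E :: "'a set set" and vs :: "'a list" and n :: nat
  assumes "simple_graph V E"
    and "n = card V" and "n \<ge> 2"
    and "distinct vs" and "set vs = V"
  shows "isoperimetric_number V E
       \<le> Min ((\<lambda>m. \<Sum>i<m. laplacian_eigenvalues vs E ! i - real (degree_sequence vs E ! i)) `
               {m::nat. real n / 2 \<le> real m \<and> m < n})"
proof -
  have len: "length vs = n" using assms by (metis distinct_card)
  let ?F = "\<lambda>m. \<Sum>i<m. laplacian_eigenvalues vs E ! i - real (degree_sequence vs E ! i)"
  have bound: "isoperimetric_number V E \<le> ?F m" if m: "real n / 2 \<le> real m" "m < n" for m
  proof -
    obtain J where J: "J \<subseteq> {..<length vs}" "card J = m"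
      and deg: "(\<Sum>i<m. degree_sequence vs E ! i) = (\<Sum>j\<in>J. degree_of E (vs ! j))"
      using degree_sequence_prefix_index_set[of m vs E] m len by auto
    define U where "U = (!) vs ` ({..<length vs} - J)"
    have U: "U \<subseteq> V" using assms(5) by (auto simp: U_def)
    have "inj_on ((!) vs) ({..<length vs} - J)" by (rule inj_on_nth[OF assms(4)]) auto
    hence cU: "card U = n - m"
      using J card_Diff_subset[of J "{..<length vs}"] finite_subset[OF J(1)]
      by (simp add: U_def card_image len)
    have "isoperimetric_number V E \<le> card (edge_boundary V E U) / card U"
      using assms(2,5) U cU m by (intro isoperimetric_number_le) auto
    also have "\<dots> \<le> (\<Sum>i<m. laplacian_eigenvalues vs E ! i) - (\<Sum>j\<in>J. real (degree_of E (vs ! j)))"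
    proof -
      have "J \<noteq> {}" "J \<noteq> {..<length vs}" using J m assms(3) len by auto
      from degree_sum_plus_boundary_ratio_le[OF assms(1,4,5) J(1) this]
      show ?thesis by (simp add: U_def J(2))
    qed
    also have "\<dots> = ?F m" using deg by (simp add: sum_subtractf flip: of_nat_sum)
    finally show ?thesis .
  qed
  \<comment> \<open>For \<open>n \<ge> 2\<close> the value \<open>m = n - 1\<close> is admissible, so the minimum is taken over a nonempty set.\<close>
  have "n - 1 \<in> {m. real n / 2 \<le> real m \<and> m < n}" using assms(3) by auto
  thus ?thesis by (subst Min_ge_iff) (use bound in auto)
qed

end
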